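(* Let $b>0$ be a public budget and let $V=\times_{j=1}^m V_j$ be a valuation distribution of an additive buyer over $m$ items that is independent across items. Then $$\mathrm{Rev}^b(V)\le 8\,\mathrm{SRev}^b(V)+24\,\mathrm{BRev}^b(V).$$ In particular, the better of selling each item separately and selling the grand bundle extracts a constant fraction of the optimal revenue: $\max\{\mathrm{SRev}^b(V),\mathrm{BRev}^b(V)\}\ge \tfrac1{32}\mathrm{Rev}^b(V)$.
   Context: A seller sells $m$ heterogeneous indivisible items (one copy each) to one buyer. The buyer's type is a vector $v\in\mathbb{R}_{\ge 0}^m$ of item values; his value for a set $S$ of items is $\sum_{j\in S}v_j$. The type is drawn from a discrete (finitely supported) distribution $V$, with support $T$ and probability mass function $f$; $V$ is independent across items if it is a product $\times_j V_j$. The seller knows $V$ and the budget $b$ but not $v$. Write $\|v\|_1=\sum_j |v_j|$. A mechanism is a pair $\pi:T\to[0,1]^m$, $p:T\to\mathbb{R}$, extended by $\pi(\varnothing)=0$, $p(\varnothing)=0$. It is truthful (interim IC and IR) if $\pi(t)^\top t-p(t)\ge \pi(t')^\top t-p(t')$ for all $t\in T$, $t'\in T\cup\{\varnothing\}$. $\mathrm{Rev}^b(V)$ is the maximum of $\sum_{t\in T}f(t)p(t)$ over truthful mechanisms that also satisfy $p(t)\le b$ for all $t\in T$. $\mathrm{SRev}^b(V)$ is the maximum expected revenue obtainable by posting item prices $p_1,\dots,p_m\ge0$, where a buyer of type $v$ buys a set $S$ maximizing $\sum_{j\in S}(v_j-p_j)$ subject to $\sum_{j\in S}p_j\le b$ (ties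 broken in favor of the seller). $\mathrm{BRev}^b(V)=\max_{0\le p\le b}\, p\cdot\Pr_{v\sim V}[\|v\|_1\ge p]$ is the maximum revenue from pricing the grand bundle. *)

theory Defs
  imports "HOL-Probability.Probability"
begin

text \<open>
  The items are the elements of a finite type \<open>'m\<close>, a buyer type is a value vector
  \<open>'m \<Rightarrow> real\<close>, and its joint distribution is a \<open>pmf\<close> whose support \<open>set_pmf V\<close> is the type
  space. The optimal revenues are suprema of reals; for finitely supported \<open>V\<close> and \<open>b \<ge> 0\<close> the
  sets involved are nonempty and bounded above (proved below), and the suprema are attained.
\<close>

text \<open>
  A mechanism is an allocation rule \<open>\<pi>\<close> with a payment rule \<open>p\<close>; only the values on the support
  matter. The last conjunct of \<open>truthful\<close> is the deviation to the null report, which has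
  zero allocation and zero payment.
\<close>

definition feasible_alloc ::
  "('m::finite \<Rightarrow> real) pmf \<Rightarrow> (('m \<Rightarrow> real) \<Rightarrow> 'm \<Rightarrow> real) \<Rightarrow> bool" where
  "feasible_alloc V \<pi> \<longleftrightarrow> (\<forall>t\<in>set_pmf V. \<forall>j. \<pi> t j \<in> {0..1})"

definition truthful ::
  "('m::finite \<Rightarrow> real) pmf \<Rightarrow> (('m \<Rightarrow> real) \<Rightarrow> 'm \<Rightarrow> real) \<Rightarrow> (('m \<Rightarrow> real) \<Rightarrow> real) \<Rightarrow> bool" where
  "truthful V \<pi> p \<longleftrightarrow>
     (\<forall>t\<in>set_pmf V.
        (\<forall>t'\<in>set_pmf V. (\<Sum>j\<in>UNIV. \<pi> t j * t j) - p t \<ge> (\<Sum>j\<in>UNIV. \<pi> t' j * t j) - p t') \<and>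
        (\<Sum>j\<in>UNIV. \<pi> t j * t j) - p t \<ge> 0)"

definition revenue :: "('m::finite \<Rightarrow> real) pmf \<Rightarrow> (('m \<Rightarrow> real) \<Rightarrow> real) \<Rightarrow> real" where
  "revenue V p = (\<Sum>t\<in>set_pmf V. pmf V t * p t)"

definition Rev_set :: "real \<Rightarrow> ('m::finite \<Rightarrow> real) pmf \<Rightarrow> real set" where
  "Rev_set b V =
     {revenue V p | \<pi> p. feasible_alloc V \<pi> \<and> truthful V \<pi> p \<and> (\<forall>t\<in>set_pmf V. p t \<le> b)}"

definition Rev :: "real \<Rightarrow> ('m::finite \<Rightarrow> real) pmf \<Rightarrow> real" where
  "Rev b V = Sup (Rev_set b V)"

definition demand ::
  "real \<Rightarrow> ('m::finite \<Rightarrow> real) \<Rightarrow> ('m \<Rightarrow> real) \<Rightarrow> 'm set set" where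
  "demand b q v =
     {S. (\<Sum>j\<in>S. q j) \<le> b \<and>
         (\<forall>S'. (\<Sum>j\<in>S'. q j) \<le> b \<longrightarrow> (\<Sum>j\<in>S'. v j - q j) \<le> (\<Sum>j\<in>S. v j - q j))}"

text \<open>Taking the maximum over the demand set breaks ties in favor of the seller.\<close>

definition item_payment ::
  "real \<Rightarrow> ('m::finite \<Rightarrow> real) \<Rightarrow> ('m \<Rightarrow> real) \<Rightarrow> real" where
  "item_payment b q v = Max ((\<lambda>S. \<Sum>j\<in>S. q j) ` demand b q v)"

definition SRev_set :: "real \<Rightarrow> ('m::finite \<Rightarrow> real) pmf \<Rightarrow> real set" where
  "SRev_set b V = {revenue V (item_payment b q) | q. \<forall>j. 0 \<le> q j}"

definition SRev :: "real \<Rightarrow> ('m::finite \<Rightarrow> real) pmf \<Rightarrow> real" where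
  "SRev b V = Sup (SRev_set b V)"

definition BRev_set :: "real \<Rightarrow> ('m::finite \<Rightarrow> real) pmf \<Rightarrow> real set" where
  "BRev_set b V = {q * measure_pmf.prob V {v. (\<Sum>j\<in>UNIV. \<bar>v j\<bar>) \<ge> q} | q. 0 \<le> q \<and> q \<le> b}"

definition BRev :: "real \<Rightarrow> ('m::finite \<Rightarrow> real) pmf \<Rightarrow> real" where
  "BRev b V = Sup (BRev_set b V)"

lemma revenue_le:
  assumes "finite (set_pmf V)" and "\<And>t. t \<in> set_pmf V \<Longrightarrow> p t \<le> b"
  shows "revenue V p \<le> b"
proof -
  have "revenue V p \<le> (\<Sum>t\<in>set_pmf V. pmf V t * b)"
    unfolding revenue_def by (intro sum_mono mult_left_mono assms) auto
  also have "\<dots> = b"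
    using sum_pmf_eq_1[OF assms(1) order_refl] by (simp flip: sum_distrib_right)
  finally show ?thesis .
qed

lemma demand_nonempty:
  assumes "b \<ge> 0"
  shows "demand b q v \<noteq> {}"
proof -
  let ?F = "{S. (\<Sum>j\<in>S. q j) \<le> b}"
  have "finite ?F" "{} \<in> ?F" using assms by auto
  then have "Max ((\<lambda>S. \<Sum>j\<in>S. v j - q j) ` ?F) \<in> (\<lambda>S. \<Sum>j\<in>S. v j - q j) ` ?F"
    by (intro Max_in) blast+
  then obtain S where S: "S \<in> ?F"
    "(\<Sum>j\<in>S. v j - q j) = Max ((\<lambda>S. \<Sum>j\<in>S. v j - q j) ` ?F)" by auto
  have "(\<Sum>j\<in>S'. v j - q j) \<le> (\<Sum>j\<in>S. v j - q j)" if "S' \<in> ?F" for S'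
    unfolding S(2) using that \<open>finite ?F\<close> by (intro Max_ge) auto
  with S(1) have "S \<in> demand b q v" by (auto simp: demand_def)
  then show ?thesis by blast
qed

lemma item_payment_le:
  assumes "b \<ge> 0"
  shows "item_payment b q v \<le> b"
  unfolding item_payment_def
  using demand_nonempty[OF assms, of q v] by (subst Max_le_iff) (auto simp: demand_def)

lemma Rev_set_nonempty:
  assumes "b \<ge> 0"
  shows "Rev_set b V \<noteq> {}"
proof -
  have "revenue V (\<lambda>_. 0) \<in> Rev_set b V"
    unfolding Rev_set_def
    by (rule CollectI, rule exI[of _ "\<lambda>_ _. 0"], rule exI[of _ "\<lambda>_. 0"])
       (use assms in \<open>auto simp: feasible_alloc_def truthful_def\<close>)
  then show ?thesis by blast
qed

lemma Rev_set_bdd_above: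
  assumes "finite (set_pmf V)"
  shows "bdd_above (Rev_set b V)"
  unfolding Rev_set_def by (rule bdd_aboveI[of _ b]) (use revenue_le[OF assms] in blast)

lemma SRev_set_nonempty: "SRev_set b V \<noteq> {}"
  unfolding SRev_set_def by (auto intro!: exI[of _ "\<lambda>_. 0"])

lemma SRev_set_bdd_above:
  assumes "finite (set_pmf V)" and "b \<ge> 0"
  shows "bdd_above (SRev_set b V)"
  unfolding SRev_set_def
  by (rule bdd_aboveI[of _ b]) (use revenue_le[OF assms(1)] item_payment_le[OF assms(2)] in blast)

lemma BRev_set_nonempty:
  assumes "b \<ge> 0"
  shows "BRev_set b V \<noteq> {}"
  unfolding BRev_set_def using assms by auto

lemma BRev_set_bdd_above: "bdd_above (BRev_set b V)"
proof (rule bdd_aboveI[of _ b])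
  fix x assume "x \<in> BRev_set b V"
  then obtain q where q: "0 \<le> q" "q \<le> b"
    and x: "x = q * measure_pmf.prob V {v. (\<Sum>j\<in>UNIV. \<bar>v j\<bar>) \<ge> q}"
    by (auto simp: BRev_set_def)
  have "x \<le> q" unfolding x by (intro mult_right_le_one_le q measure_nonneg measure_pmf.prob_le_1)
  with q show "x \<le> b" by linarith
qed

end

theory Submission
  imports Defs
begin

text \<open>
  Types of total value at least \<open>b/2\<close> pay at most \<open>b\<close> and are covered by the bundle price \<open>b/2\<close>; if
  they have probability more than \<open>1/2\<close>, that price alone suffices. On the remaining types the budget
  never binds, so selling item by item earns at least \<open>r/2\<close>, where \<open>r\<close> is the sum over the items \<open>j\<close>
  of the best revenue \<open>q * Pr[q \<le> v j < b/2]\<close>. There the payment of a truthful mechanism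
  is at most its revenue from the buyer's favorite item, a single-item mechanism once the other values
  are fixed (in expectation at most \<open>r\<close>), plus the values of the other items. Among these, the values
  above \<open>r\<close> have expected sum at most \<open>r\<close>, since some other item must be at least as valuable.
  The values up to \<open>r\<close> have a sum of variance at most \<open>2 r\<^sup>2\<close>, which therefore concentrates, so the
  bundle price \<open>\<mu> - 2 r\<close> recovers their mean \<open>\<mu>\<close> up to \<open>2 r\<close>. Altogether this is at most
  \<open>4 r + 4 BRev \<le> 8 SRev + 4 BRev\<close>.
\<close>

section \<open>Expectations over finite product distributions\<close>

lemma expectation_pmf_sum:
  fixes g :: "'a \<Rightarrow> real"
  assumes "finite (set_pmf M)"
  shows "measure_pmf.expectation M g = (\<Sum>x\<in>set_pmf M. pmf M x * g x)"
  using assms by (subst integral_measure_pmf_real[of "set_pmf M"]) (auto simp: mult.commute)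

lemma revenue_eq_expectation:
  "finite (set_pmf M) \<Longrightarrow> revenue M p = measure_pmf.expectation M p"
  by (simp add: expectation_pmf_sum revenue_def)

lemma expectation_pmf_mono:
  fixes g h :: "'a \<Rightarrow> real"
  assumes "finite (set_pmf M)" "\<And>x. x \<in> set_pmf M \<Longrightarrow> g x \<le> h x"
  shows "measure_pmf.expectation M g \<le> measure_pmf.expectation M h"
  unfolding expectation_pmf_sum[OF assms(1)] by (intro sum_mono mult_left_mono assms) auto

lemma expectation_of_bool:
  "measure_pmf.expectation M (\<lambda>x. of_bool (P x)) = measure_pmf.prob M {x. P x}"
proof -
  have "(\<lambda>x. of_bool (P x) :: real) = indicator {x. P x}"
    by (auto simp: indicator_def)
  then show ?thesis by simp
qed

lemma finite_set_Pi_pmf: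
  fixes V :: "'m::finite \<Rightarrow> 'a pmf"
  assumes "\<And>j. finite (set_pmf (V j))"
  shows "finite (set_pmf (Pi_pmf UNIV d V))"
  using assms by (subst set_Pi_pmf) (auto intro!: finite_PiE_dflt)

text \<open>Coordinate \<open>j\<close> is independent of the others, so redrawing it does not
  change the joint law.\<close>

lemma Pi_pmf_resample:
  fixes V :: "'m::finite \<Rightarrow> 'a pmf"
  shows "bind_pmf (Pi_pmf UNIV d V) (\<lambda>v. map_pmf (\<lambda>x. v(j := x)) (V j)) = Pi_pmf UNIV d V"
proof -
  let ?W = "Pi_pmf (UNIV - {j}) d V"
  have D: "Pi_pmf UNIV d V = bind_pmf (V j) (\<lambda>y. bind_pmf ?W (\<lambda>w. return_pmf (w(j := y))))"
    using Pi_pmf_insert'[of "UNIV - {j}" j d V] by (simp add: insert_absorb)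
  \<comment> \<open>The old value at \<open>j\<close> is overwritten; what remains is the rest drawn
    first and coordinate \<open>j\<close> second.\<close>
  have "bind_pmf (Pi_pmf UNIV d V) (\<lambda>v. map_pmf (\<lambda>x. v(j := x)) (V j)) =
      bind_pmf ?W (\<lambda>w. bind_pmf (V j) (\<lambda>x. return_pmf (w(j := x))))"
    by (simp add: D bind_assoc_pmf bind_return_pmf map_pmf_def)
  also have "\<dots> = Pi_pmf UNIV d V"
    unfolding D by (rule bind_commute_pmf)
  finally show ?thesis .
qed

text \<open>Fubini in one coordinate. Factors not depending on \<open>v j\<close> leave the inner
  expectation, which is how independence is used below.\<close>

lemma expectation_resample:
  fixes V :: "'m::finite \<Rightarrow> 'a pmf" and g :: "('m \<Rightarrow> 'a) \<Rightarrow> real"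
  assumes fin: "\<And>j. finite (set_pmf (V j))"
  shows "measure_pmf.expectation (Pi_pmf UNIV d V) g =
    measure_pmf.expectation (Pi_pmf UNIV d V)
      (\<lambda>v. measure_pmf.expectation (V j) (\<lambda>x. g (v(j := x))))"
proof -
  have finD: "finite (set_pmf (Pi_pmf UNIV d V))"
    using fin by (rule finite_set_Pi_pmf)
  show ?thesis
    using pmf_expectation_bind[OF finD, where p = "Pi_pmf UNIV d V"
        and f = "\<lambda>v. map_pmf (\<lambda>x. v(j := x)) (V j)" and h = g]
    by (simp add: Pi_pmf_resample fin expectation_pmf_sum[OF finD, of "\<lambda>v. \<integral>x. g (v(j := x)) \<partial>V j"])
qed

section \<open>Selling a single item\<close>

text \<open>A discrete form of Myerson's theorem: a truthful single-item mechanism earns no more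
  than the bound on posted prices. The weights need not sum to 1, so it applies to a part of a
  distribution. The induction removes the largest value and moves its mass to the next one.\<close>

lemma single_item_revenue_le:
  fixes w a t :: "real \<Rightarrow> real"
  assumes "finite L" "L \<subseteq> {0..}"
    and "\<And>x. x \<in> L \<Longrightarrow> 0 \<le> w x"
    and "\<And>x. x \<in> L \<Longrightarrow> 0 \<le> a x" "\<And>x. x \<in> L \<Longrightarrow> a x \<le> 1"
    and IR: "\<And>x. x \<in> L \<Longrightarrow> t x \<le> a x * x"
    and IC: "\<And>x y. x \<in> L \<Longrightarrow> y \<in> L \<Longrightarrow> a y * x - t y \<le> a x * x - t x"
    and R: "0 \<le> R" "\<And>q. q \<in> L \<Longrightarrow> q * (\<Sum>x\<in>{x\<in>L. q \<le> x}. w x) \<le> R"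
  shows "(\<Sum>x\<in>L. w x * t x) \<le> R"
proof -
  \<comment> \<open>The factor \<open>a (Max L)\<close> leaves room for the increment
    \<open>R * (a z - a m)\<close> that each new largest value costs.\<close>
  have "(\<Sum>x\<in>L. w x * t x) \<le> (if L = {} then 0 else R * a (Max L))"
    using \<open>finite L\<close> assms(2-4) IR IC R(2)
  proof (induction L arbitrary: w rule: finite_linorder_max_induct)
    case empty
    then show ?case by simp
  next
    case (insert z L)
    note z = \<open>\<forall>x\<in>L. x < z\<close>
    have znotin: "z \<notin> L" using z by auto
    have up: "{x \<in> insert z L. z \<le> x} = {z}" using z by auto
    have zR: "z * w z \<le> R"
      using insert.prems(6)[of z] by (simp only: up) simp
    have maxz: "Max (insert z L) = z"
      using z \<open>finite L\<close> by (intro Max_eqI) (auto intro: less_imp_le)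
    show ?case
    proof (cases "L = {}")
      case True
      have "w z * t z \<le> w z * (a z * z)"
        using insert.prems by (intro mult_left_mono) auto
      also have "\<dots> = z * w z * a z" by simp
      also have "\<dots> \<le> R * a z"
        using zR insert.prems(3)[of z] by (intro mult_right_mono) auto
      finally show ?thesis using True by simp
    next
      case False
      define m where "m = Max L"
      have m: "m \<in> L" "m < z" and mge: "\<And>x. x \<in> L \<Longrightarrow> x \<le> m"
        using False \<open>finite L\<close> z by (auto simp: m_def)
      \<comment> \<open>A price \<open>q\<close> in \<open>L\<close> is at most \<open>m\<close>, so
        it sells to \<open>m\<close> and to \<open>z\<close> alike; moving the mass preserves its
        posted-price revenue.\<close>
      define w' where "w' = w(m := w m + w z)"
      have shift: "(\<Sum>x\<in>{x\<in>L. Q x}. w' x * h x) = (\<Sum>x\<in>{x\<in>L. Q x}. w x * h x) + w z * h m"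
        if "Q m" for Q and h :: "real \<Rightarrow> real"
      proof -
        have f: "finite {x\<in>L. Q x}" "m \<in> {x\<in>L. Q x}" using m that \<open>finite L\<close> by auto
        show ?thesis
          unfolding sum.remove[OF f] by (simp add: w'_def algebra_simps)
      qed
      have IH: "(\<Sum>x\<in>L. w' x * t x) \<le> R * a m"
      proof -
        have "q * (\<Sum>x\<in>{x\<in>L. q \<le> x}. w' x) \<le> R" if "q \<in> L" for q
        proof -
          have "{x \<in> insert z L. q \<le> x} = insert z {x \<in> L. q \<le> x}"
            using z that by (auto intro: less_imp_le)
          then show ?thesis
            using shift[of "\<lambda>x. q \<le> x" "\<lambda>_. 1"] mge[OF that] insert.prems(6)[of q] that
              znotin \<open>finite L\<close> by (simp add: add.commute)
        qed
        moreover have "0 \<le> w' x" if "x \<in> L" for x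
          using that insert.prems(2) m by (simp add: w'_def)
        ultimately show ?thesis
          using insert.IH[of w'] insert.prems False by (simp add: m_def)
      qed
      have "(\<Sum>x\<in>insert z L. w x * t x) = (\<Sum>x\<in>L. w' x * t x) + w z * (t z - t m)"
        using shift[of "\<lambda>_. True" t] znotin \<open>finite L\<close> by (simp add: algebra_simps)
      \<comment> \<open>Type \<open>z\<close> does not gain by reporting \<open>m\<close>.\<close>
      also have "w z * (t z - t m) \<le> w z * (z * (a z - a m))"
        using insert.prems(5)[of z m] insert.prems(2)[of z] m
        by (intro mult_left_mono) (auto simp: algebra_simps)
      also have "\<dots> = z * w z * (a z - a m)" by simp
      also have "\<dots> \<le> R * (a z - a m)"
      proof (rule mult_right_mono[OF zR])
        \<comment> \<open>Adding the two incentive constraints between \<open>z\<close> and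
          \<open>m\<close> shows that the allocation is monotone.\<close>
        have "0 \<le> (z - m) * (a z - a m)"
          using insert.prems(5)[of z m] insert.prems(5)[of m z] m by (auto simp: algebra_simps)
        then show "0 \<le> a z - a m"
          using m by (simp add: zero_le_mult_iff)
      qed
      finally show ?thesis
        using IH by (simp add: maxz algebra_simps)
    qed
  qed
  also have "\<dots> \<le> R"
    using assms(5)[OF Max_in[OF \<open>finite L\<close>]] \<open>0 \<le> R\<close> by (auto intro: mult_left_le)
  finally show ?thesis .
qed

section \<open>Item prices\<close>

lemma item_payment_nonneg:
  assumes "0 \<le> b" "\<And>j. 0 \<le> q j"
  shows "0 \<le> item_payment b q v"
  unfolding item_payment_def
  using demand_nonempty[OF assms(1), of q v] by (subst Max_ge_iff) (auto intro: sum_nonneg assms)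

text \<open>A buyer whose total value is at most the budget can afford every item that he wants.\<close>

lemma item_payment_ge:
  assumes "\<And>j. 0 \<le> v j" "(\<Sum>j\<in>UNIV. v j) \<le> b"
  shows "(\<Sum>j\<in>UNIV. q j * of_bool (q j \<le> v j)) \<le> item_payment b q v"
proof -
  let ?S = "{j. q j \<le> v j}"
  have "(\<Sum>j\<in>?S. q j) \<le> (\<Sum>j\<in>?S. v j)" by (intro sum_mono) auto
  also have "\<dots> \<le> (\<Sum>j\<in>UNIV. v j)" by (intro sum_mono2) (auto intro: assms)
  finally have afford: "(\<Sum>j\<in>?S. q j) \<le> b" using assms(2) by simp
  have best: "(\<Sum>j\<in>S'. v j - q j) \<le> (\<Sum>j\<in>?S. v j - q j)" for S'
  proof -
    have "(\<Sum>j\<in>S'. v j - q j) \<le> (\<Sum>j\<in>S' \<inter> ?S. v j - q j)"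
      by (intro sum_mono2[of S' "S' \<inter> ?S" "\<lambda>j. - (v j - q j)", simplified sum_negf neg_le_iff_le]) auto
    also have "\<dots> \<le> (\<Sum>j\<in>?S. v j - q j)" by (intro sum_mono2) auto
    finally show ?thesis .
  qed
  have "?S \<in> demand b q v" using afford best by (auto simp: demand_def)
  then have "(\<Sum>j\<in>?S. q j) \<le> item_payment b q v"
    unfolding item_payment_def by (intro Max_ge) auto
  then show ?thesis by (simp add: sum.If_cases of_bool_def if_distrib cong: if_cong)
qed

section \<open>The core\<close>

text \<open>Write \<open>x\<^sup>2\<close> as the integral of \<open>2 * y\<close> over
  \<open>y\<close> from 0 to \<open>x\<close> and exchange it with the expectation. The integrand is
  then at most twice a posted-price revenue, and the truncation at \<open>r\<close> bounds the
  length of the interval.\<close>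

lemma second_moment_le:
  assumes fin: "finite (set_pmf M)" and nonneg: "set_pmf M \<subseteq> {0..}"
    and R: "\<And>y. 0 \<le> y \<Longrightarrow> y * measure_pmf.prob M {y..<c} \<le> R" and "0 \<le> r"
  shows "measure_pmf.expectation M (\<lambda>x. (x * of_bool (x \<le> r \<and> x < c))\<^sup>2) \<le> 2 * r * R"
proof -
  have sq: "((\<lambda>y. of_bool (y \<le> x \<and> x \<le> r \<and> x < c) * (2 * y)) has_integral
      (x * of_bool (x \<le> r \<and> x < c))\<^sup>2) {0..r}" if "0 \<le> x" for x
  proof (cases "x \<le> r \<and> x < c")
    case True
    have "((\<lambda>y. 2 * y) has_integral (x\<^sup>2 - 0\<^sup>2)) {0..x}"
      using that by (intro fundamental_theorem_of_calculus)
        (auto intro!: derivative_eq_intros simp: has_real_derivative_iff_has_vector_derivative[symmetric])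
    then have "((\<lambda>y. if y \<in> {0..x} then 2 * y else 0) has_integral x\<^sup>2) {0..r}"
      using True by (subst has_integral_restrict) auto
    moreover have "(if y \<in> {0..x} then 2 * y else 0) = of_bool (y \<le> x \<and> x \<le> r \<and> x < c) * (2 * y)"
      if "y \<in> {0..r}" for y using that True by auto
    ultimately show ?thesis
      using True by (subst has_integral_cong[symmetric]) auto
  qed auto
  have "((\<lambda>y. \<Sum>x\<in>set_pmf M. pmf M x * (of_bool (y \<le> x \<and> x \<le> r \<and> x < c) * (2 * y))) has_integral
      measure_pmf.expectation M (\<lambda>x. (x * of_bool (x \<le> r \<and> x < c))\<^sup>2)) {0..r}"
    unfolding expectation_pmf_sum[OF fin]
    using nonneg by (intro has_integral_sum fin has_integral_mult_right sq) auto
  moreover have "((\<lambda>y. 2 * R) has_integral (2 * r * R)) {0..r}"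
    using has_integral_const_real[of "2 * R" 0 r] \<open>0 \<le> r\<close> by (simp add: mult_ac)
  moreover have "(\<Sum>x\<in>set_pmf M. pmf M x * (of_bool (y \<le> x \<and> x \<le> r \<and> x < c) * (2 * y))) \<le> 2 * R"
    if "y \<in> {0..r}" for y
  proof -
    have "(\<Sum>x\<in>set_pmf M. pmf M x * (of_bool (y \<le> x \<and> x \<le> r \<and> x < c) * (2 * y)))
        \<le> (\<Sum>x\<in>set_pmf M. pmf M x * (of_bool (y \<le> x \<and> x < c) * (2 * y)))"
      using that by (intro sum_mono mult_left_mono) auto
    also have "\<dots> = 2 * (y * measure_pmf.prob M {x. y \<le> x \<and> x < c})"
      unfolding expectation_of_bool[symmetric] expectation_pmf_sum[OF fin]
      by (simp add: sum_distrib_left mult_ac)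
    also have "{x. y \<le> x \<and> x < c} = {y..<c}" by auto
    also have "2 * (y * measure_pmf.prob M {y..<c}) \<le> 2 * R"
      using R[of y] that by simp
    finally show ?thesis .
  qed
  ultimately show ?thesis by (rule has_integral_le)
qed

text \<open>Covariances of independent terms vanish, and each variance is at most the second
  moment.\<close>

lemma variance_sum_Pi_pmf_le:
  fixes V :: "'m::finite \<Rightarrow> 'a pmf" and d :: 'a and h :: "'m \<Rightarrow> 'a \<Rightarrow> real"
  assumes fin: "\<And>j. finite (set_pmf (V j))"
  defines "\<mu> \<equiv> measure_pmf.expectation (Pi_pmf UNIV d V) (\<lambda>v. \<Sum>j\<in>UNIV. h j (v j))"
  shows "measure_pmf.expectation (Pi_pmf UNIV d V) (\<lambda>v. ((\<Sum>j\<in>UNIV. h j (v j)) - \<mu>)\<^sup>2)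
    \<le> (\<Sum>j\<in>UNIV. measure_pmf.expectation (V j) (\<lambda>x. (h j x)\<^sup>2))"
proof -
  let ?D = "Pi_pmf UNIV d V"
  let ?E = "measure_pmf.expectation ?D"
  have int: "integrable (measure_pmf ?D) g" for g :: "_ \<Rightarrow> real"
    by (intro integrable_measure_pmf_finite finite_set_Pi_pmf fin)
  have intV: "integrable (measure_pmf (V j)) g" for j and g :: "_ \<Rightarrow> real"
    by (intro integrable_measure_pmf_finite fin)
  define m where "m j = measure_pmf.expectation (V j) (h j)" for j
  define z where "z j x = h j x - m j" for j x
  have one: "?E (\<lambda>v. g (v j)) = measure_pmf.expectation (V j) g" for j and g :: "_ \<Rightarrow> real"
    by (subst expectation_resample[where j = j, OF fin]) simp
  have mu: "\<mu> = (\<Sum>j\<in>UNIV. m j)"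
    unfolding \<mu>_def m_def by (simp add: int one)
  have z0: "measure_pmf.expectation (V j) (z j) = 0" for j
    unfolding z_def by (simp add: intV m_def)
  \<comment> \<open>Resampling \<open>j\<close> alone keeps \<open>z i (v i)\<close> fixed and
    averages \<open>z j\<close> to 0.\<close>
  have cross: "?E (\<lambda>v. z i (v i) * z j (v j)) = 0" if "i \<noteq> j" for i j
    using that by (subst expectation_resample[where j = j, OF fin]) (simp add: z0)
  have diag: "?E (\<lambda>v. z j (v j) * z j (v j)) \<le> measure_pmf.expectation (V j) (\<lambda>x. (h j x)\<^sup>2)" for j
  proof -
    have "?E (\<lambda>v. z j (v j) * z j (v j)) =
        measure_pmf.expectation (V j) (\<lambda>x. (h j x)\<^sup>2 - 2 * m j * h j x + (m j)\<^sup>2)"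
      by (subst one[of "\<lambda>x. z j x * z j x"]) (simp add: z_def power2_eq_square algebra_simps)
    also have "\<dots> = measure_pmf.expectation (V j) (\<lambda>x. (h j x)\<^sup>2) - (m j)\<^sup>2"
      by (simp add: intV m_def[symmetric] power2_eq_square)
    finally show ?thesis by simp
  qed
  have "((\<Sum>j\<in>UNIV. h j (v j)) - \<mu>)\<^sup>2 = (\<Sum>i\<in>UNIV. \<Sum>j\<in>UNIV. z i (v i) * z j (v j))" for v
    by (simp add: mu z_def sum_subtractf[symmetric] power2_eq_square sum_product)
  then have "?E (\<lambda>v. ((\<Sum>j\<in>UNIV. h j (v j)) - \<mu>)\<^sup>2) =
      (\<Sum>i\<in>UNIV. \<Sum>j\<in>UNIV. ?E (\<lambda>v. z i (v i) * z j (v j)))"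
    by (simp add: int)
  also have "\<dots> = (\<Sum>i\<in>UNIV. ?E (\<lambda>v. z i (v i) * z i (v i)))"
  proof (rule sum.cong[OF refl])
    fix i
    have "(\<Sum>j\<in>UNIV. ?E (\<lambda>v. z i (v i) * z j (v j))) =
        (\<Sum>j\<in>UNIV. if i = j then ?E (\<lambda>v. z i (v i) * z i (v i)) else 0)"
      using cross by (intro sum.cong) auto
    then show "(\<Sum>j\<in>UNIV. ?E (\<lambda>v. z i (v i) * z j (v j))) = ?E (\<lambda>v. z i (v i) * z i (v i))"
      by simp
  qed
  also have "\<dots> \<le> (\<Sum>j\<in>UNIV. measure_pmf.expectation (V j) (\<lambda>x. (h j x)\<^sup>2))"
    by (intro sum_mono diag)
  finally show ?thesis .
qed

section \<open>Independent items and a public budget\<close>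

locale independent_items =
  fixes V :: "'m::finite \<Rightarrow> real pmf" and b :: real
  assumes b_pos: "b > 0"
    and fin: "\<And>j. finite (set_pmf (V j))"
    and nonneg: "\<And>j. set_pmf (V j) \<subseteq> {0..}"
begin

abbreviation D :: "('m \<Rightarrow> real) pmf" where
  "D \<equiv> Pi_pmf UNIV 0 V"

abbreviation E :: "(('m \<Rightarrow> real) \<Rightarrow> real) \<Rightarrow> real" where
  "E \<equiv> measure_pmf.expectation D"

abbreviation total :: "('m \<Rightarrow> real) \<Rightarrow> real" where
  "total v \<equiv> \<Sum>j\<in>UNIV. v j"

lemma finite_D: "finite (set_pmf D)"
  using fin by (rule finite_set_Pi_pmf)

lemma integrable_D: "integrable (measure_pmf D) g" for g :: "_ \<Rightarrow> real"
  by (intro integrable_measure_pmf_finite finite_D)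

lemma E_sum: "E (\<lambda>v. \<Sum>i\<in>I. g i v) = (\<Sum>i\<in>I. E (g i))"
  by (rule Bochner_Integration.integral_sum) (rule integrable_D)

lemma set_D: "v \<in> set_pmf D \<longleftrightarrow> (\<forall>j. v j \<in> set_pmf (V j))"
  by (auto simp: set_Pi_pmf PiE_dflt_def)

lemma D_nonneg: "v \<in> set_pmf D \<Longrightarrow> 0 \<le> v j"
  using nonneg[of j] by (auto simp: set_D)

lemma component_le_total: "v \<in> set_pmf D \<Longrightarrow> v j \<le> total v"
  by (rule member_le_sum) (auto simp: D_nonneg)

lemmas E_mono = expectation_pmf_mono[OF finite_D]

lemma E_nonneg: "(\<And>v. v \<in> set_pmf D \<Longrightarrow> 0 \<le> g v) \<Longrightarrow> 0 \<le> E g"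
  using E_mono[of "\<lambda>_. 0" g] by simp

lemma E_resample: "E g = E (\<lambda>v. measure_pmf.expectation (V j) (\<lambda>x. g (v(j := x))))"
  using fin by (rule expectation_resample)

lemma E_component: "E (\<lambda>v. g (v j)) = measure_pmf.expectation (V j) g"
  by (subst E_resample[of _ j]) simp

subsection \<open>Benchmarks\<close>

lemma BRev_ge:
  assumes "0 \<le> q" "q \<le> b"
  shows "q * E (\<lambda>v. of_bool (q \<le> total v)) \<le> BRev b D"
proof -
  have "E (\<lambda>v. of_bool (q \<le> total v)) \<le> E (\<lambda>v. of_bool (q \<le> (\<Sum>j\<in>UNIV. \<bar>v j\<bar>)))"
    by (rule E_mono) (simp add: D_nonneg)
  then have "q * E (\<lambda>v. of_bool (q \<le> total v)) \<le> q * measure_pmf.prob D {v. q \<le> (\<Sum>j\<in>UNIV. \<bar>v j\<bar>)}"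
    unfolding expectation_of_bool[of D "\<lambda>v. q \<le> (\<Sum>j\<in>UNIV. \<bar>v j\<bar>)"]
    by (intro mult_left_mono assms)
  also have "\<dots> \<le> BRev b D"
    unfolding BRev_def using assms
    by (intro cSup_upper BRev_set_bdd_above) (auto simp: BRev_set_def)
  finally show ?thesis .
qed

lemma BRev_nonneg: "0 \<le> BRev b D"
  using BRev_ge[of 0] b_pos by simp

text \<open>If the total value is at most \<open>b\<close>, the budget does not bind and the items
  decouple; all other types pay at least 0.\<close>

lemma SRev_ge:
  assumes "\<And>j. 0 \<le> q j"
  shows "(\<Sum>j\<in>UNIV. q j * E (\<lambda>v. of_bool (q j \<le> v j \<and> total v \<le> b))) \<le> SRev b D"
proof -
  have "(\<Sum>j\<in>UNIV. q j * E (\<lambda>v. of_bool (q j \<le> v j \<and> total v \<le> b))) =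
      E (\<lambda>v. \<Sum>j\<in>UNIV. q j * of_bool (q j \<le> v j \<and> total v \<le> b))"
    by (simp only: E_sum integral_mult_right_zero)
  also have "\<dots> \<le> E (item_payment b q)"
  proof (rule E_mono)
    fix v assume v: "v \<in> set_pmf D"
    show "(\<Sum>j\<in>UNIV. q j * of_bool (q j \<le> v j \<and> total v \<le> b)) \<le> item_payment b q v"
    proof (cases "total v \<le> b")
      case True
      then show ?thesis using item_payment_ge[of v b q] D_nonneg[OF v] by simp
    next
      case False
      then show ?thesis using item_payment_nonneg[of b q v] assms b_pos by simp
    qed
  qed
  also have "\<dots> \<le> SRev b D"
    unfolding SRev_def revenue_eq_expectation[OF finite_D, symmetric]
    using assms b_pos finite_D by (intro cSup_upper SRev_set_bdd_above) (auto simp: SRev_set_def)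
  finally show ?thesis .
qed

lemma SRev_nonneg: "0 \<le> SRev b D"
  using SRev_ge[of "\<lambda>_. 0"] by simp

text \<open>Raising a price to the next support point keeps the same buyers, so the maximum over the
  finite support is a maximum over all prices. A price above the whole support sells
  nothing.\<close>

lemma ex_best_price:
  "\<exists>q\<ge>0. \<forall>y\<ge>0. y * measure_pmf.prob (V j) {y..<b/2} \<le> q * measure_pmf.prob (V j) {q..<b/2}"
proof -
  let ?S = "set_pmf (V j)"
  let ?g = "\<lambda>y. y * measure_pmf.prob (V j) {y..<b/2}"
  have "Max (?g ` ?S) \<in> ?g ` ?S" by (intro Max_in) (auto simp: fin set_pmf_not_empty)
  then obtain q where q: "q \<in> ?S" "?g q = Max (?g ` ?S)" by auto
  have best: "?g x \<le> ?g q" if "x \<in> ?S" for x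
    unfolding q(2) using that fin by (intro Max_ge) auto
  have q0: "0 \<le> q" using q(1) nonneg[of j] by auto
  have "?g y \<le> ?g q" if "0 \<le> y" for y
  proof (cases "\<exists>x\<in>?S. y \<le> x")
    case False
    then have "measure_pmf.prob (V j) {y..<b/2} = 0"
      by (subst measure_pmf_zero_iff) (auto simp: disjoint_iff)
    then show ?thesis using q0 by simp
  next
    case True
    define x where "x = Min {x\<in>?S. y \<le> x}"
    have "x \<in> {x\<in>?S. y \<le> x}"
      unfolding x_def using True by (intro Min_in) (auto simp: fin)
    moreover have "x \<le> z" if "z \<in> ?S" "y \<le> z" for z
      unfolding x_def using that by (intro Min_le) (auto simp: fin)
    ultimately have x: "x \<in> ?S" "y \<le> x" and "{y..<b/2} \<inter> ?S = {x..<b/2} \<inter> ?S"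
      by auto
    then have "measure_pmf.prob (V j) {y..<b/2} = measure_pmf.prob (V j) {x..<b/2}"
      by (metis measure_Int_set_pmf)
    then have "?g y \<le> ?g x" using x by (simp add: mult_right_mono)
    with best[OF x(1)] show ?thesis by linarith
  qed
  with q0 show ?thesis by blast
qed

definition price :: "'m \<Rightarrow> real" where
  "price j = (SOME q. 0 \<le> q \<and>
     (\<forall>y\<ge>0. y * measure_pmf.prob (V j) {y..<b/2} \<le> q * measure_pmf.prob (V j) {q..<b/2}))"

definition rho :: "'m \<Rightarrow> real" where
  "rho j = price j * measure_pmf.prob (V j) {price j..<b/2}"

lemma price_nonneg: "0 \<le> price j"
  and rho_ge: "0 \<le> y \<Longrightarrow> y * measure_pmf.prob (V j) {y..<b/2} \<le> rho j"
  using someI_ex[OF ex_best_price[of j]] unfolding price_def rho_def by blast+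

lemma rho_nonneg: "0 \<le> rho j"
  by (simp add: rho_def price_nonneg)

lemma rho_ge_expectation:
  assumes "0 \<le> y"
  shows "y * measure_pmf.expectation (V j) (\<lambda>x. of_bool (y \<le> x \<and> x < b/2)) \<le> rho j"
proof -
  have "{x. y \<le> x \<and> x < b/2} = {y..<b/2}" by auto
  then show ?thesis using rho_ge[OF assms, of j] by (simp only: expectation_of_bool)
qed

text \<open>If both \<open>v j\<close> and the sum of the other values are below \<open>b/2\<close>,
  the total stays below \<open>b\<close> and item \<open>j\<close> sells whenever its price is met.
  The condition on the others is independent of \<open>v j\<close> and has probability at least 1/2,
  which costs the factor 2.\<close>

lemma sum_rho_le_SRev:
  assumes half: "1/2 \<le> E (\<lambda>v. of_bool (total v < b/2))"
  shows "(\<Sum>j\<in>UNIV. rho j) \<le> 2 * SRev b D"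
proof -
  have "rho j / 2 \<le> price j * E (\<lambda>v. of_bool (price j \<le> v j \<and> total v \<le> b))" for j
  proof -
    let ?rest = "\<lambda>v::'m \<Rightarrow> real. of_bool ((\<Sum>k\<in>UNIV-{j}. v k) < b/2) :: real"
    let ?Q = "measure_pmf.expectation (V j) (\<lambda>x. of_bool (price j \<le> x \<and> x < b/2))"
    have upd: "(\<Sum>k\<in>UNIV-{j}. (v(j := x)) k) = (\<Sum>k\<in>UNIV-{j}. v k)" for v :: "'m \<Rightarrow> real" and x
      by (intro sum.cong) auto
    have tot: "total v = v j + (\<Sum>k\<in>UNIV-{j}. v k)" for v :: "'m \<Rightarrow> real"
      by (rule sum.remove) auto
    have "{x. price j \<le> x \<and> x < b/2} = {price j..<b/2}" by auto
    then have rho: "rho j = price j * ?Q"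
      by (simp only: rho_def expectation_of_bool)
    have "1/2 \<le> E ?rest"
      using half by (rule order_trans) (rule E_mono, use D_nonneg[of _ j] in \<open>force simp: tot\<close>)
    then have "?Q / 2 \<le> ?Q * E ?rest"
      using mult_left_mono[of "1/2" "E ?rest" ?Q] by simp
    \<comment> \<open>Independence: resampling \<open>j\<close> does not affect the sum of the other
      values.\<close>
    also have "\<dots> = E (\<lambda>v. of_bool (price j \<le> v j \<and> v j < b/2) * ?rest v)"
      by (subst E_resample[of _ j]) (simp add: upd del: fun_upd_apply add: fun_upd_same)
    also have "\<dots> \<le> E (\<lambda>v. of_bool (price j \<le> v j \<and> total v \<le> b))"
      by (rule E_mono) (auto simp: tot)
    finally show ?thesis
      using mult_left_mono[OF _ price_nonneg[of j]] by (fastforce simp: rho)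
  qed
  then have "(\<Sum>j\<in>UNIV. rho j / 2) \<le> (\<Sum>j\<in>UNIV. price j * E (\<lambda>v. of_bool (price j \<le> v j \<and> total v \<le> b)))"
    by (intro sum_mono)
  also have "\<dots> \<le> SRev b D" by (intro SRev_ge price_nonneg)
  finally show ?thesis by (simp add: sum_divide_distrib[symmetric])
qed

subsection \<open>Favorite item, tail and core\<close>

text \<open>With the other values fixed, charging the payment net of the value of the other items
  received turns the mechanism into a truthful one for item \<open>j\<close> alone. Restricting it
  to the values selected by \<open>P\<close> keeps it truthful, and these lie below
  \<open>b/2\<close>, so \<open>rho j\<close> bounds the posted-price revenue.\<close>

lemma favorite_item_le:
  assumes feas: "feasible_alloc D \<pi>" and truth: "truthful D \<pi> p"
    and P: "\<And>v. v \<in> set_pmf D \<Longrightarrow> P v \<Longrightarrow> v j < b/2"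
  shows "E (\<lambda>v. of_bool (P v) * (p v - (\<Sum>k\<in>UNIV-{j}. \<pi> v k * v k))) \<le> rho j"
proof -
  let ?g = "\<lambda>v. of_bool (P v) * (p v - (\<Sum>k\<in>UNIV-{j}. \<pi> v k * v k))"
  have "measure_pmf.expectation (V j) (\<lambda>x. ?g (v(j := x))) \<le> rho j" if v: "v \<in> set_pmf D" for v
  proof -
    define L where "L = {x \<in> set_pmf (V j). P (v(j := x))}"
    define t where "t x = p (v(j := x)) - (\<Sum>k\<in>UNIV-{j}. \<pi> (v(j := x)) k * v k)" for x
    have inD: "v(j := x) \<in> set_pmf D" if "x \<in> L" for x
      using that v by (auto simp: set_D L_def)
    \<comment> \<open>The utilities coincide, so the constraints of the given mechanism carry over
      to the single-item one.\<close>
    have util: "(\<Sum>k\<in>UNIV. \<pi> (v(j := y)) k * (v(j := x)) k) - p (v(j := y)) =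
        \<pi> (v(j := y)) j * x - t y" for x y
    proof -
      have "(\<Sum>k\<in>UNIV. \<pi> (v(j := y)) k * (v(j := x)) k) =
          \<pi> (v(j := y)) j * x + (\<Sum>k\<in>UNIV-{j}. \<pi> (v(j := y)) k * (v(j := x)) k)"
        by (subst sum.remove[of UNIV j]) (simp_all only: finite UNIV_I fun_upd_same)
      also have "(\<Sum>k\<in>UNIV-{j}. \<pi> (v(j := y)) k * (v(j := x)) k) =
          (\<Sum>k\<in>UNIV-{j}. \<pi> (v(j := y)) k * v k)"
        by (intro sum.cong) auto
      finally show ?thesis by (simp add: t_def del: fun_upd_apply)
    qed
    have "(\<Sum>x\<in>L. pmf (V j) x * t x) \<le> rho j"
    proof (rule single_item_revenue_le[where a = "\<lambda>x. \<pi> (v(j := x)) j"])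
      show "finite L" "L \<subseteq> {0..}" using fin nonneg[of j] by (auto simp: L_def)
      show "0 \<le> \<pi> (v(j := x)) j" "\<pi> (v(j := x)) j \<le> 1" if "x \<in> L" for x
        using feas inD[OF that] by (auto simp: feasible_alloc_def)
      show "t x \<le> \<pi> (v(j := x)) j * x" if "x \<in> L" for x
      proof -
        have "0 \<le> (\<Sum>k\<in>UNIV. \<pi> (v(j := x)) k * (v(j := x)) k) - p (v(j := x))"
          using truth inD[OF that] unfolding truthful_def by blast
        then show ?thesis unfolding util by simp
      qed
      show "\<pi> (v(j := y)) j * x - t y \<le> \<pi> (v(j := x)) j * x - t x" if "x \<in> L" "y \<in> L" for x y
        using truth inD[OF that(1)] inD[OF that(2)] unfolding truthful_def util[symmetric] by blast
      show "q * (\<Sum>x\<in>{x\<in>L. q \<le> x}. pmf (V j) x) \<le> rho j" if "q \<in> L" for q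
      proof -
        have q: "0 \<le> q" using that nonneg[of j] by (auto simp: L_def)
        have "x < b/2" if "x \<in> L" for x
          using P[OF inD[OF that]] that by (simp add: L_def)
        then have "measure_pmf.prob (V j) {x\<in>L. q \<le> x} \<le> measure_pmf.prob (V j) {q..<b/2}"
          by (intro measure_pmf.finite_measure_mono) auto
        moreover have "(\<Sum>x\<in>{x\<in>L. q \<le> x}. pmf (V j) x) = measure_pmf.prob (V j) {x\<in>L. q \<le> x}"
          by (intro measure_measure_pmf_finite[symmetric]) (auto simp: L_def fin)
        ultimately show ?thesis
          using rho_ge[OF q, of j] mult_left_mono[OF _ q] by (metis order_trans)
      qed
    qed (auto simp: rho_nonneg)
    also have "(\<Sum>x\<in>L. pmf (V j) x * t x) = measure_pmf.expectation (V j) (\<lambda>x. ?g (v(j := x)))"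
    proof -
      have "(\<Sum>x\<in>L. pmf (V j) x * t x) = (\<Sum>x\<in>set_pmf (V j). pmf (V j) x * (of_bool (P (v(j := x))) * t x))"
        unfolding L_def by (intro sum.mono_neutral_cong_left) (auto simp: fin)
      moreover have "of_bool (P (v(j := x))) * t x = ?g (v(j := x))" for x
        by (auto simp: t_def intro!: sum.cong)
      ultimately show ?thesis by (simp add: expectation_pmf_sum fin)
    qed
    finally show ?thesis .
  qed
  then have "E ?g \<le> E (\<lambda>_. rho j)"
    by (subst E_resample[of _ j]) (rule E_mono)
  then show ?thesis by simp
qed

abbreviation r :: real where
  "r \<equiv> \<Sum>j\<in>UNIV. rho j"

lemma r_nonneg: "0 \<le> r"
  by (intro sum_nonneg rho_nonneg)

text \<open>A union bound over the items \<open>j\<close> that may beat \<open>k\<close>: if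
  \<open>k\<close> is not the favorite and all values are below \<open>b/2\<close>, the summand of
  the favorite is already \<open>v k\<close> whenever \<open>v k > r\<close>. Each summand involves
  only two coordinates.\<close>

definition tail :: "'m \<Rightarrow> ('m \<Rightarrow> real) \<Rightarrow> real" where
  "tail k v = (\<Sum>j\<in>UNIV-{k}. v k * of_bool (r < v k \<and> v k < b/2) * of_bool (v k \<le> v j \<and> v j < b/2))"

definition core :: "'m \<Rightarrow> real \<Rightarrow> real" where
  "core k x = x * of_bool (x \<le> r \<and> x < b/2)"

text \<open>Given \<open>v k\<close>, use it as a price for item \<open>j\<close>: this earns at
  most \<open>rho j\<close>, hence at most \<open>r\<close> over all \<open>j\<close>. What is left
  is \<open>r\<close> times the probability that \<open>v k\<close> lies between \<open>r\<close>
  and \<open>b/2\<close>, which is bounded by the revenue of price \<open>r\<close> for item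
  \<open>k\<close>, so by \<open>rho k\<close>.\<close>

lemma tail_le: "E (\<lambda>v. \<Sum>k\<in>UNIV. tail k v) \<le> r"
proof -
  have "E (tail k) \<le> rho k" for k
  proof -
    let ?T = "\<lambda>v. of_bool (r < v k \<and> v k < b/2) :: real"
    have "E (tail k) = (\<Sum>j\<in>UNIV-{k}. E (\<lambda>v. v k * ?T v * of_bool (v k \<le> v j \<and> v j < b/2)))"
      unfolding tail_def by (rule E_sum)
    also have "\<dots> \<le> (\<Sum>j\<in>UNIV-{k}. rho j * E ?T)"
    proof (rule sum_mono)
      fix j assume "j \<in> UNIV - {k}"
      then have "E (\<lambda>v. v k * ?T v * of_bool (v k \<le> v j \<and> v j < b/2)) =
          E (\<lambda>v. ?T v * (v k * measure_pmf.expectation (V j) (\<lambda>x. of_bool (v k \<le> x \<and> x < b/2))))"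
        by (subst E_resample[of _ j]) (simp add: mult_ac)
      also have "\<dots> \<le> E (\<lambda>v. ?T v * rho j)"
        by (intro E_mono mult_left_mono rho_ge_expectation) (simp_all add: D_nonneg)
      also have "\<dots> = rho j * E ?T" by (simp add: mult.commute)
      finally show "E (\<lambda>v. v k * ?T v * of_bool (v k \<le> v j \<and> v j < b/2)) \<le> rho j * E ?T" .
    qed
    also have "\<dots> = (\<Sum>j\<in>UNIV-{k}. rho j) * E ?T"
      by (simp add: sum_distrib_right)
    also have "\<dots> \<le> r * E ?T"
      by (intro mult_right_mono sum_mono2 E_nonneg) (auto simp: rho_nonneg)
    also have "\<dots> \<le> r * E (\<lambda>v. of_bool (r \<le> v k \<and> v k < b/2))"
      by (intro mult_left_mono E_mono r_nonneg) auto
    also have "\<dots> \<le> rho k"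
      using rho_ge_expectation[OF r_nonneg, of k]
      by (simp only: E_component[of "\<lambda>x. of_bool (r \<le> x \<and> x < b/2)"])
    finally show ?thesis .
  qed
  then show ?thesis unfolding E_sum by (rule sum_mono)
qed

text \<open>By Chebyshev's inequality, the bundle price \<open>\<mu> - 2 r\<close>, where \<open>\<mu>\<close> is the mean of the core,
  is accepted with probability at least one half. If it exceeds the budget, then so is \<open>b\<close>.\<close>

lemma core_le: "E (\<lambda>v. \<Sum>k\<in>UNIV. core k (v k)) \<le> 2 * BRev b D + 2 * r \<or> b \<le> 2 * BRev b D"
proof -
  define Y where "Y v = (\<Sum>k\<in>UNIV. core k (v k))" for v
  define \<mu> where "\<mu> = E Y"
  have Y_le: "Y v \<le> total v" if "v \<in> set_pmf D" for v
    unfolding Y_def core_def by (intro sum_mono) (auto simp: D_nonneg[OF that])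
  have var: "E (\<lambda>v. (Y v - \<mu>)\<^sup>2) \<le> 2 * r\<^sup>2"
  proof -
    have "E (\<lambda>v. (Y v - \<mu>)\<^sup>2) \<le> (\<Sum>k\<in>UNIV. measure_pmf.expectation (V k) (\<lambda>x. (core k x)\<^sup>2))"
      unfolding Y_def \<mu>_def by (rule variance_sum_Pi_pmf_le[OF fin])
    also have "\<dots> \<le> (\<Sum>k\<in>UNIV. 2 * r * rho k)"
      unfolding core_def by (intro sum_mono second_moment_le fin nonneg rho_ge r_nonneg)
    also have "\<dots> = 2 * r\<^sup>2"
      by (simp add: sum_distrib_left[symmetric] power2_eq_square)
    finally show ?thesis .
  qed
  show ?thesis
  proof (cases "r = 0")
    \<comment> \<open>Chebyshev's inequality needs \<open>r > 0\<close>. For \<open>r = 0\<close>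
      the core vanishes, since values are nonnegative.\<close>
    case True
    have "Y v = 0" if "v \<in> set_pmf D" for v
      unfolding Y_def core_def True using D_nonneg[OF that]
      by (intro sum.neutral) (auto simp: order.antisym)
    then have "E Y \<le> 0" using E_mono[of Y "\<lambda>_. 0"] by simp
    then show ?thesis using BRev_nonneg True by (simp add: Y_def[abs_def])
  next
    case False
    then have r: "0 < r" using r_nonneg by simp
    \<comment> \<open>Falling short of \<open>\<mu>\<close> by more than \<open>2 * r\<close> costs
      \<open>4 * r\<^sup>2\<close>, twice the variance bound, so it has probability at most
      1/2.\<close>
    have "E (\<lambda>v. of_bool (\<not> \<mu> - 2 * r \<le> Y v) * (4 * r\<^sup>2)) \<le> E (\<lambda>v. (Y v - \<mu>)\<^sup>2)"
    proof (rule E_mono)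
      fix v
      show "of_bool (\<not> \<mu> - 2 * r \<le> Y v) * (4 * r\<^sup>2) \<le> (Y v - \<mu>)\<^sup>2"
      proof (cases "\<mu> - 2 * r \<le> Y v")
        case False
        then have "(2 * r)\<^sup>2 \<le> (\<mu> - Y v)\<^sup>2" using r by (intro power_mono) auto
        then show ?thesis by (simp add: power2_commute power_mult_distrib)
      qed simp
    qed
    with var have "E (\<lambda>v. of_bool (\<not> \<mu> - 2 * r \<le> Y v)) * (4 * r\<^sup>2) \<le> 1/2 * (4 * r\<^sup>2)"
      unfolding integral_mult_left_zero by linarith
    then have "E (\<lambda>v. of_bool (\<not> \<mu> - 2 * r \<le> Y v)) \<le> 1/2"
      by (rule mult_right_le_imp_le) (use r in simp)
    moreover have "E (\<lambda>v. of_bool (\<not> \<mu> - 2 * r \<le> Y v)) = 1 - E (\<lambda>v. of_bool (\<mu> - 2 * r \<le> Y v))"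
      by (simp add: of_bool_not_iff integrable_D)
    ultimately have half: "1/2 \<le> E (\<lambda>v. of_bool (q \<le> total v))" if "q \<le> \<mu> - 2 * r" for q
      using E_mono[of "\<lambda>v. of_bool (\<mu> - 2 * r \<le> Y v)" "\<lambda>v. of_bool (q \<le> total v)"] Y_le that
      by fastforce
    have sell: "q \<le> 2 * BRev b D" if "0 \<le> q" "q \<le> b" "q \<le> \<mu> - 2 * r" for q
      using BRev_ge[OF that(1,2)] mult_left_mono[OF half[OF that(3)] that(1)] by simp
    \<comment> \<open>Three cases: \<open>\<mu> - 2 * r\<close> is negative, is an admissible price,
      or exceeds \<open>b\<close>; in the last case the price \<open>b\<close> is used.\<close>
    show ?thesis
      using sell[of b] sell[of "\<mu> - 2 * r"] BRev_nonneg b_pos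
      unfolding \<mu>_def Y_def[abs_def] by linarith
  qed
qed

section \<open>Decomposition of the payment and the final bound\<close>

definition favorite :: "('m \<Rightarrow> real) \<Rightarrow> 'm" where
  "favorite v = (SOME j. \<forall>k. v k \<le> v j)"

lemma le_favorite: "v k \<le> v (favorite v)"
proof -
  have "Max (range v) \<in> range v" by (intro Max_in) auto
  then obtain j where "v j = Max (range v)" by (metis imageE)
  then have "\<forall>k. v k \<le> v j" by simp
  then show ?thesis unfolding favorite_def by (rule someI2) blast
qed

text \<open>For a total below \<open>b/2\<close>, only the summand of the favorite item survives in
  the sum over \<open>j\<close>, and it omits the value received from the other items. Each of those
  values is in the core if it is at most \<open>r\<close>, and otherwise in the tail with the
  favorite as witness.\<close>

lemma payment_decomposition:
  assumes feas: "feasible_alloc D \<pi>" and v: "v \<in> set_pmf D" and "p v \<le> b"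
  shows "p v \<le> b * of_bool (b/2 \<le> total v)
    + (\<Sum>j\<in>UNIV. of_bool (total v < b/2 \<and> favorite v = j) * (p v - (\<Sum>k\<in>UNIV-{j}. \<pi> v k * v k)))
    + (\<Sum>k\<in>UNIV. tail k v) + (\<Sum>k\<in>UNIV. core k (v k))"
proof (cases "b/2 \<le> total v")
  case True
  have "0 \<le> tail k v" "0 \<le> core k (v k)" for k
    unfolding tail_def core_def by (simp_all add: sum_nonneg D_nonneg[OF v])
  then have "0 \<le> (\<Sum>k\<in>UNIV. tail k v)" "0 \<le> (\<Sum>k\<in>UNIV. core k (v k))"
    by (auto intro: sum_nonneg)
  with True \<open>p v \<le> b\<close> show ?thesis by simp
next
  case False
  let ?f = "favorite v"
  have tail_nonneg: "0 \<le> tail k v" and core_nonneg: "0 \<le> core k (v k)" for k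
    unfolding tail_def core_def by (simp_all add: sum_nonneg D_nonneg[OF v])
  have small: "v k < b/2" for k
    using component_le_total[OF v, of k] False by simp
  have "\<pi> v k * v k \<le> tail k v + core k (v k)" if "k \<noteq> ?f" for k
  proof -
    have "\<pi> v k * v k \<le> v k"
      using feas v D_nonneg[OF v, of k] by (intro mult_left_le_one_le) (auto simp: feasible_alloc_def)
    also have "v k \<le> tail k v + core k (v k)"
    proof (cases "v k \<le> r")
      case True
      then show ?thesis using tail_nonneg[of k] small[of k] by (simp add: core_def)
    next
      case False
      have "v k = v k * of_bool (r < v k \<and> v k < b/2) * of_bool (v k \<le> v ?f \<and> v ?f < b/2)"
        using False small le_favorite[of v k] by simp
      also have "\<dots> \<le> tail k v"
        unfolding tail_def
        by (rule member_le_sum[where i = ?f]) (use that in \<open>simp_all add: D_nonneg[OF v]\<close>)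
      finally show ?thesis using core_nonneg[of k] by simp
    qed
    finally show ?thesis .
  qed
  then have "(\<Sum>k\<in>UNIV-{?f}. \<pi> v k * v k) \<le> (\<Sum>k\<in>UNIV-{?f}. tail k v + core k (v k))"
    by (intro sum_mono) auto
  also have "\<dots> \<le> (\<Sum>k\<in>UNIV. tail k v + core k (v k))"
    by (intro sum_mono2) (auto simp: tail_nonneg core_nonneg)
  finally have others: "(\<Sum>k\<in>UNIV-{?f}. \<pi> v k * v k) \<le> (\<Sum>k\<in>UNIV. tail k v) + (\<Sum>k\<in>UNIV. core k (v k))"
    by (simp add: sum.distrib)
  have "(\<Sum>j\<in>UNIV. of_bool (total v < b/2 \<and> ?f = j) * (p v - (\<Sum>k\<in>UNIV-{j}. \<pi> v k * v k))) =
      (\<Sum>j\<in>UNIV. if ?f = j then p v - (\<Sum>k\<in>UNIV-{j}. \<pi> v k * v k) else 0)"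
    using False by (intro sum.cong) auto
  also have "\<dots> = p v - (\<Sum>k\<in>UNIV-{?f}. \<pi> v k * v k)"
    by simp
  finally show ?thesis using others False by simp
qed

lemma mechanism_revenue_le:
  assumes feas: "feasible_alloc D \<pi>" and truth: "truthful D \<pi> p"
    and budget: "\<And>v. v \<in> set_pmf D \<Longrightarrow> p v \<le> b"
  shows "E p \<le> 8 * SRev b D + 24 * BRev b D"
proof (cases "1/2 \<le> E (\<lambda>v. of_bool (total v < b/2))")
  \<comment> \<open>The bundle price \<open>b/2\<close> sells with probability at least 1/2 and
    earns \<open>b/4\<close>, while no mechanism earns more than \<open>b\<close>.\<close>
  case False
  have "E (\<lambda>v. of_bool (b/2 \<le> total v)) = E (\<lambda>v. 1 - of_bool (total v < b/2))"
    by (intro arg_cong[of _ _ E]) (auto simp: fun_eq_iff)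
  also have "\<dots> = 1 - E (\<lambda>v. of_bool (total v < b/2))"
    by (simp add: integrable_D)
  finally have "1/2 \<le> E (\<lambda>v. of_bool (b/2 \<le> total v))" using False by simp
  then have "b/2 * (1/2) \<le> b/2 * E (\<lambda>v. of_bool (b/2 \<le> total v))"
    using b_pos by (intro mult_left_mono) auto
  also have "\<dots> \<le> BRev b D" using b_pos by (intro BRev_ge) auto
  finally have "b/4 \<le> BRev b D" by simp
  moreover have "E p \<le> b" using E_mono[of p "\<lambda>_. b"] budget by simp
  ultimately show ?thesis using SRev_nonneg b_pos by linarith
next
  case True
  let ?S = "\<lambda>j v. of_bool (total v < b/2 \<and> favorite v = j) * (p v - (\<Sum>k\<in>UNIV-{j}. \<pi> v k * v k))"
  have "E p \<le> E (\<lambda>v. b * of_bool (b/2 \<le> total v) + (\<Sum>j\<in>UNIV. ?S j v)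
      + (\<Sum>k\<in>UNIV. tail k v) + (\<Sum>k\<in>UNIV. core k (v k)))"
    by (intro E_mono payment_decomposition feas budget)
  also have "\<dots> = b * E (\<lambda>v. of_bool (b/2 \<le> total v)) + (\<Sum>j\<in>UNIV. E (?S j))
      + E (\<lambda>v. \<Sum>k\<in>UNIV. tail k v) + E (\<lambda>v. \<Sum>k\<in>UNIV. core k (v k))"
    by (simp only: Bochner_Integration.integral_add Bochner_Integration.integral_sum
        integral_mult_right_zero integrable_D)
  finally have decomposition: "E p \<le> \<dots>" .
  have "b * E (\<lambda>v. of_bool (b/2 \<le> total v)) \<le> 2 * BRev b D"
    using BRev_ge[of "b/2"] b_pos by simp
  moreover have "(\<Sum>j\<in>UNIV. E (?S j)) \<le> r"
    by (intro sum_mono favorite_item_le[OF feas truth]) (blast intro: le_less_trans[OF component_le_total])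
  moreover have "E p \<le> b" using E_mono[of p "\<lambda>_. b"] budget by simp
  \<comment> \<open>The four terms are at most \<open>2 * BRev\<close>, \<open>r\<close>,
    \<open>r\<close> and \<open>2 * BRev + 2 * r\<close>, where \<open>r\<close> is at most
    \<open>2 * SRev\<close>. In the other alternative of \<open>core_le\<close>, the revenue is at
    most \<open>b\<close>, hence at most \<open>2 * BRev\<close>.\<close>
  ultimately show ?thesis
    using decomposition tail_le core_le sum_rho_le_SRev[OF True] SRev_nonneg BRev_nonneg by linarith
qed

lemma Rev_le: "Rev b D \<le> 8 * SRev b D + 24 * BRev b D"
  unfolding Rev_def
proof (rule cSup_least)
  show "Rev_set b D \<noteq> {}" using b_pos by (intro Rev_set_nonempty) simp
  show "x \<le> 8 * SRev b D + 24 * BRev b D" if "x \<in> Rev_set b D" for x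
    using that mechanism_revenue_le by (auto simp: Rev_set_def revenue_eq_expectation[OF finite_D])
qed

end

theorem theorem1:
  fixes V :: "'m::finite \<Rightarrow> real pmf" and b :: real
  assumes "b > 0"
    and "\<And>j. finite (set_pmf (V j))"
    and "\<And>j. set_pmf (V j) \<subseteq> {0..}"
  shows "Rev b (Pi_pmf UNIV 0 V) \<le> 8 * SRev b (Pi_pmf UNIV 0 V) + 24 * BRev b (Pi_pmf UNIV 0 V)
    \<and> max (SRev b (Pi_pmf UNIV 0 V)) (BRev b (Pi_pmf UNIV 0 V)) \<ge> 1 / 32 * Rev b (Pi_pmf UNIV 0 V)"
proof -
  interpret independent_items V b by standard (use assms in auto)
  \<comment> \<open>The coefficients 8 and 24 add up to 32, which gives the bound on the
    maximum.\<close>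
  show ?thesis using Rev_le by linarith
qed

end
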